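(* Let $P=\frac12P_1+\frac12P_2$, where $P_1$ and $P_2$ are the uniform probability distributions on $[0,1]$ and $[\frac12,\frac32]$, respectively. The optimal set of three-means for $P$ is $\{\frac14,\frac34,\frac54\}$, with quantization error $V_3(P)=\frac1{48}$.
   Context: For a Borel probability measure $P$ on $\mathbb{R}$ and a nonempty finite $\alpha\subset\mathbb{R}$, put $V(P;\alpha)=\int\min_{a\in\alpha}(x-a)^2\,dP(x)$. The $n$th quantization error is $V_n(P)=\inf\{V(P;\alpha):\alpha\subset\mathbb{R},\ 1\le\mathrm{card}(\alpha)\le n\}$, and an optimal set of $n$-means is a set $\alpha$ with $1\le\mathrm{card}(\alpha)\le n$ and $V(P;\alpha)=V_n(P)$. The measure $P$ here has density $\frac12$ on $[0,\frac12]\cup[1,\frac32]$, $1$ on $[\frac12,1]$, and $0$ elsewhere. *)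

theory Defs
  imports "HOL-Probability.Probability"
begin

definition mixture :: "real \<Rightarrow> 'a measure \<Rightarrow> 'a measure \<Rightarrow> 'a measure" where
  "mixture c M N = measure_of (space M) (sets M)
     (\<lambda>A. ennreal c * emeasure M A + ennreal (1 - c) * emeasure N A)"

lemma space_mixture [simp]: "space (mixture c M N) = space M"
  by (simp add: mixture_def)

lemma sets_mixture [simp, measurable_cong]: "sets (mixture c M N) = sets M"
  by (simp add: mixture_def)

text \<open>\<^const>\<open>measure_of\<close> yields the null measure unless the given set function is a measure; the
  next lemma rules this out for measures on a common sigma-algebra.\<close>

lemma emeasure_mixture:
  assumes "sets N = sets M" and "A \<in> sets M"
  shows "emeasure (mixture c M N) A = ennreal c * emeasure M A + ennreal (1 - c) * emeasure N A"
proof (rule emeasure_measure_of[OF mixture_def])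
  show "sets M \<subseteq> Pow (space M)"
    using sets.space_closed .
  show "A \<in> sets (mixture c M N)"
    using assms by simp
  show "positive (sets (mixture c M N))
      (\<lambda>A. ennreal c * emeasure M A + ennreal (1 - c) * emeasure N A)"
    by (simp add: positive_def)
  show "countably_additive (sets (mixture c M N))
      (\<lambda>A. ennreal c * emeasure M A + ennreal (1 - c) * emeasure N A)"
  proof (rule countably_additiveI)
    fix B :: "nat \<Rightarrow> 'a set"
    assume B: "range B \<subseteq> sets (mixture c M N)" "disjoint_family B"
    have "(\<Sum>i. ennreal c * emeasure M (B i) + ennreal (1 - c) * emeasure N (B i)) =
        ennreal c * (\<Sum>i. emeasure M (B i)) + ennreal (1 - c) * (\<Sum>i. emeasure N (B i))"
      by (simp add: suminf_add[symmetric] ennreal_suminf_cmult)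
    also have "\<dots> = ennreal c * emeasure M (\<Union>i. B i) + ennreal (1 - c) * emeasure N (\<Union>i. B i)"
      using B assms by (simp add: suminf_emeasure)
    finally show "(\<Sum>i. ennreal c * emeasure M (B i) + ennreal (1 - c) * emeasure N (B i)) =
        ennreal c * emeasure M (\<Union>i. B i) + ennreal (1 - c) * emeasure N (\<Union>i. B i)" .
  qed
qed

lemma prob_space_mixture:
  assumes "prob_space M" "prob_space N" "sets N = sets M" "0 \<le> c" "c \<le> 1"
  shows "prob_space (mixture c M N)"
proof
  have "space N = space M"
    using assms(3) by (rule sets_eq_imp_space_eq)
  then have "emeasure (mixture c M N) (space M) = ennreal c + ennreal (1 - c)"
    using assms prob_space.emeasure_space_1[of M] prob_space.emeasure_space_1[of N]
    by (simp add: emeasure_mixture)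
  also have "\<dots> = 1"
    using assms by (simp flip: ennreal_plus)
  finally show "emeasure (mixture c M N) (space (mixture c M N)) = 1"
    by simp
qed

text \<open>The cost is a Lebesgue integral with values in \<^typ>\<open>ennreal\<close>, so that it is \<open>\<infinity>\<close>
  rather than \<open>0\<close> for measures with infinite second moment.\<close>

definition distortion :: "real measure \<Rightarrow> real set \<Rightarrow> ennreal" where
  "distortion P \<alpha> = (\<integral>\<^sup>+ x. ennreal (MIN a\<in>\<alpha>. (x - a)\<^sup>2) \<partial>P)"

text \<open>Infinite sets have cardinality \<open>0\<close> in HOL, so \<open>1 \<le> card \<alpha>\<close> says that \<open>\<alpha>\<close> is finite
  and nonempty.\<close>

definition quantization_error :: "nat \<Rightarrow> real measure \<Rightarrow> ennreal" where
  "quantization_error n P = Inf {distortion P \<alpha> | \<alpha>. 1 \<le> card \<alpha> \<and> card \<alpha> \<le> n}"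

definition optimal_n_means :: "nat \<Rightarrow> real measure \<Rightarrow> real set \<Rightarrow> bool" where
  "optimal_n_means n P \<alpha> \<longleftrightarrow>
     1 \<le> card \<alpha> \<and> card \<alpha> \<le> n \<and> distortion P \<alpha> = quantization_error n P"

end

theory Submission
  imports Defs
begin

text \<open>Integrating against \<open>P\<close> is averaging the Lebesgue integrals over \<open>[0, 1]\<close> and \<open>[1/2, 3/2]\<close>, and
  the proof keeps these two overlapping intervals apart instead of working with the density.
  Let \<open>a \<le> b \<le> c\<close> be the points, possibly with repetitions, which covers all sets of at most three
  points. The midpoints \<open>u = (a + b) / 2\<close> and \<open>v = (b + c) / 2\<close> cut each of the two intervals into
  cells on which the squared distance to the set is \<open>(x - a)\<^sup>2\<close>, \<open>(x - b)\<^sup>2\<close> and \<open>(x - c)\<^sup>2\<close>. A cell of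
  length \<open>h\<close> costs \<open>h\<^sup>3/12\<close> plus \<open>h\<close> times the squared distance of its point from its centre.
  The distortion is half the sum of the six cell costs, and the claim is that this sum is at least
  \<open>1/24\<close>.

  The sum is bounded below as a function of arbitrary cuts \<open>u \<le> v\<close>, forgetting that they are
  midpoints. If one outer cell contains a whole interval of length \<open>1\<close>, it costs at
  least \<open>1/12\<close> already. If \<open>u \<le> 1/2\<close> and \<open>1 \<le> v\<close>, the cubes \<open>h\<^sup>3/12\<close> alone suffice, because
  \<open>(1 - p)\<^sup>3 + (1 + p)\<^sup>3 = 2 + 6 p\<^sup>2\<close>. In the remaining cases an outer point has to serve two cells with
  different centres; this mismatch compensates the linear decrease of the cubes
  (\<open>overlapping_cells_cost\<close>). Reflection at \<open>3/4\<close> exchanges the cases that are mirror images. Every estimate is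
  strict except at \<open>u = 1/2\<close>, \<open>v = 1\<close> (\<open>cuts_unique\<close>), and there the excess over \<open>1/24\<close> is a sum of squares
  vanishing only for \<open>(a, b, c) = (1/4, 3/4, 5/4)\<close> (\<open>cut_cost_at_half_and_one\<close>). This gives both the
  value and the uniqueness.\<close>

section \<open>The cost of a partition into three cells\<close>

text \<open>The integral of \<open>(x - a)\<^sup>2\<close> over \<open>[s, t]\<close>, split into the variance part and the displacement of \<open>a\<close>
  from the centre; see \<open>has_integral_cell_cost\<close>.\<close>

definition cell_cost :: "real \<Rightarrow> real \<Rightarrow> real \<Rightarrow> real" where
  "cell_cost a s t = (t - s) ^ 3 / 12 + (t - s) * ((s + t) / 2 - a)\<^sup>2"

definition clip :: "real \<Rightarrow> real \<Rightarrow> real \<Rightarrow> real" where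
  "clip l r x = max l (min r x)"

text \<open>Cuts outside \<open>[l, r]\<close> are moved to the nearer end, which makes some cells degenerate and their
  costs zero. So one formula serves all positions of \<open>u\<close> and \<open>v\<close>.\<close>

definition cut_cost ::
  "real \<Rightarrow> real \<Rightarrow> real \<Rightarrow> real \<Rightarrow> real \<Rightarrow> real \<Rightarrow> real \<Rightarrow> real" where
  "cut_cost l r u v a b c =
     cell_cost a l (clip l r u) + cell_cost b (clip l r u) (clip l r v) + cell_cost c (clip l r v) r"

lemma cell_cost_ge_cube: "s \<le> t \<Longrightarrow> (t - s) ^ 3 / 12 \<le> cell_cost a s t"
  by (simp add: cell_cost_def)

lemma cell_cost_nonneg: "s \<le> t \<Longrightarrow> 0 \<le> cell_cost a s t"
  by (simp add: cell_cost_def)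

lemma cell_cost_reflect: "cell_cost (w - a) (w - t) (w - s) = cell_cost a s t"
  unfolding cell_cost_def by (simp add: field_simps power2_eq_square)

lemma cut_cost_reflect:
  assumes "l \<le> r"
  shows "cut_cost (w - r) (w - l) (w - v) (w - u) (w - c) (w - b) (w - a) = cut_cost l r u v a b c"
proof -
  have "clip (w - r) (w - l) (w - x) = w - clip l r x" for x
    using assms by (auto simp: clip_def max_def min_def)
  then show ?thesis
    by (simp add: cut_cost_def cell_cost_reflect)
qed

text \<open>The integrand is prescribed only on the open interval, because a degenerate cell at an end of
  \<open>[l, r]\<close> need not lie in the region of its point.\<close>

lemma has_integral_cell_cost:
  assumes "s \<le> t" and m: "\<And>x. s < x \<Longrightarrow> x < t \<Longrightarrow> m x = (x - a)\<^sup>2"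
  shows "(m has_integral cell_cost a s t) {s..t}"
proof -
  have "((\<lambda>x. (x - a)\<^sup>2) has_integral (t - a) ^ 3 / 3 - (s - a) ^ 3 / 3) {s..t}"
    by (rule fundamental_theorem_of_calculus[OF assms(1)])
       (auto intro!: derivative_eq_intros simp flip: has_real_derivative_iff_has_vector_derivative)
  moreover have "(t - a) ^ 3 / 3 - (s - a) ^ 3 / 3 = cell_cost a s t"
    unfolding cell_cost_def by (simp add: field_simps power2_eq_square power3_eq_cube)
  ultimately have "((\<lambda>x. (x - a)\<^sup>2) has_integral cell_cost a s t) {s..t}"
    by simp
  then show ?thesis
    by (rule has_integral_spike_finite[of "{s, t}", rotated 2]) (auto simp: m)
qed

lemma closer_left_of_midpoint:
  fixes x p q :: real
  assumes "p \<le> q" "x \<le> (p + q) / 2"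
  shows "(x - p)\<^sup>2 \<le> (x - q)\<^sup>2"
proof -
  have "0 \<le> (q - p) * (p + q - 2 * x)"
    using assms by simp
  then show ?thesis
    by (simp add: power2_eq_square algebra_simps)
qed

lemma closer_right_of_midpoint:
  fixes x p q :: real
  assumes "p \<le> q" "(p + q) / 2 \<le> x"
  shows "(x - q)\<^sup>2 \<le> (x - p)\<^sup>2"
proof -
  have "0 \<le> (q - p) * (2 * x - p - q)"
    using assms by simp
  then show ?thesis
    by (simp add: power2_eq_square algebra_simps)
qed

lemma has_integral_cut_cost:
  assumes "l \<le> r" "a \<le> b" "b \<le> c"
  shows "((\<lambda>x. MIN d\<in>{a, b, c}. (x - d)\<^sup>2) has_integral
    cut_cost l r ((a + b) / 2) ((b + c) / 2) a b c) {l..r}"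
proof -
  define m :: "real \<Rightarrow> real" where "m x = (MIN d\<in>{a, b, c}. (x - d)\<^sup>2)" for x
  define u v where "u = (a + b) / 2" and "v = (b + c) / 2"
  have ord: "l \<le> clip l r u" "clip l r u \<le> clip l r v" "clip l r v \<le> r"
    using assms by (auto simp: clip_def u_def v_def max_def min_def)
  have "m x = (x - a)\<^sup>2" if "x < clip l r u" "l < x" for x
  proof -
    have "x \<le> (a + b) / 2" "x \<le> (a + c) / 2"
      using that assms by (auto simp: clip_def u_def max_def min_def split: if_splits)
    then have "(x - a)\<^sup>2 \<le> (x - b)\<^sup>2" "(x - a)\<^sup>2 \<le> (x - c)\<^sup>2"
      using assms by (auto intro!: closer_left_of_midpoint)
    then show ?thesis
      unfolding m_def by (intro Min_eqI) auto
  qed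
  then have A: "(m has_integral cell_cost a l (clip l r u)) {l..clip l r u}"
    using ord by (intro has_integral_cell_cost) auto
  have "m x = (x - b)\<^sup>2" if "clip l r u < x" "x < clip l r v" for x
  proof -
    have "(a + b) / 2 \<le> x" "x \<le> (b + c) / 2"
      using that assms by (auto simp: clip_def u_def v_def max_def min_def split: if_splits)
    then have "(x - b)\<^sup>2 \<le> (x - a)\<^sup>2" "(x - b)\<^sup>2 \<le> (x - c)\<^sup>2"
      using assms closer_right_of_midpoint[of a b x] closer_left_of_midpoint[of b c x] by simp_all
    then show ?thesis
      unfolding m_def by (intro Min_eqI) auto
  qed
  then have B: "(m has_integral cell_cost b (clip l r u) (clip l r v)) {clip l r u..clip l r v}"
    using ord by (intro has_integral_cell_cost) auto
  have "m x = (x - c)\<^sup>2" if "clip l r v < x" "x < r" for x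
  proof -
    have "(b + c) / 2 \<le> x" "(a + c) / 2 \<le> x"
      using that assms by (auto simp: clip_def v_def max_def min_def split: if_splits)
    then have "(x - c)\<^sup>2 \<le> (x - a)\<^sup>2" "(x - c)\<^sup>2 \<le> (x - b)\<^sup>2"
      using assms by (auto intro!: closer_right_of_midpoint)
    then show ?thesis
      unfolding m_def by (intro Min_eqI) auto
  qed
  then have C: "(m has_integral cell_cost c (clip l r v) r) {clip l r v..r}"
    using ord by (intro has_integral_cell_cost) auto
  have "(m has_integral cut_cost l r u v a b c) {l..r}"
    unfolding cut_cost_def
    using ord by (intro has_integral_combine[OF _ _ has_integral_combine[OF _ _ A B] C]) auto
  then show ?thesis
    by (simp add: m_def[abs_def] u_def v_def)
qed

section \<open>Cell costs in the two overlapping intervals\<close>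

text \<open>For the cut \<open>v = 1 - s/2\<close> the last point serves \<open>[v, 1]\<close> and \<open>[v, 3/2]\<close>, whose centres are
  \<open>1/4\<close> apart. By the parallel axis theorem this adds at least \<open>3 s (1 + s) / (1 + 2 s)\<close>, in units of \<open>1/96\<close>,
  to the two cubes; the bound \<open>3 s (1 - s)\<close> has the same linear term and is free of division.\<close>

lemma overlapping_cells_cost:
  assumes "0 \<le> s"
  shows "(s ^ 3 + (1 + s) ^ 3 + 3 * s * (1 - s)) / 96 \<le>
    cell_cost c (1 - s / 2) 1 + cell_cost c (1 - s / 2) (3 / 2)"
proof -
  \<comment> \<open>\<open>t / 2\<close> is the displacement of \<open>c\<close> from the centre of the longer cell.\<close>
  define t where "t = 5 / 2 - s / 2 - 2 * c"
  have "8 * (cell_cost c (1 - s / 2) 1 + cell_cost c (1 - s / 2) (3 / 2)) =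
      (s ^ 3 + (1 + s) ^ 3) / 12 + s * (t - 1 / 2)\<^sup>2 + (1 + s) * t\<^sup>2"
    unfolding cell_cost_def t_def by (simp add: field_simps power2_eq_square power3_eq_cube)
  also have "s * (t - 1 / 2)\<^sup>2 = s * t\<^sup>2 - s * t + s / 4"
    by (simp add: field_simps power2_eq_square)
  finally have "8 * (cell_cost c (1 - s / 2) 1 + cell_cost c (1 - s / 2) (3 / 2)) =
      8 * ((s ^ 3 + (1 + s) ^ 3 + 3 * s * (1 - s)) / 96) + ((t - s / 2)\<^sup>2 + 2 * (s * t\<^sup>2))"
    by (simp add: field_simps power2_eq_square)
  also have "\<dots> \<ge> 8 * ((s ^ 3 + (1 + s) ^ 3 + 3 * s * (1 - s)) / 96)"
    using assms by simp
  finally show ?thesis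
    by (simp only: mult_le_cancel_left_pos zero_less_numeral)
qed

lemma overlapping_cells_cost_left:
  assumes "0 \<le> s"
  shows "(s ^ 3 + (1 + s) ^ 3 + 3 * s * (1 - s)) / 96 \<le>
    cell_cost a 0 (1 / 2 + s / 2) + cell_cost a (1 / 2) (1 / 2 + s / 2)"
proof -
  have "cell_cost a 0 (1 / 2 + s / 2) = cell_cost (3 / 2 - a) (1 - s / 2) (3 / 2)"
    using cell_cost_reflect[of "3 / 2" a "1 / 2 + s / 2" 0] by (simp add: field_simps)
  moreover have "cell_cost a (1 / 2) (1 / 2 + s / 2) = cell_cost (3 / 2 - a) (1 - s / 2) 1"
    using cell_cost_reflect[of "3 / 2" a "1 / 2 + s / 2" "1 / 2"] by (simp add: field_simps)
  ultimately show ?thesis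
    using overlapping_cells_cost[OF assms, of "3 / 2 - a"] by simp
qed

section \<open>The best cuts\<close>

text \<open>In each of the following cases \<open>p\<close>, \<open>q\<close>, \<open>s\<close>, \<open>t\<close> measure, in units of \<open>1/2\<close>, by how much the
  cuts, moved into \<open>[0, 3/2]\<close>, deviate from \<open>1/2\<close> and \<open>1\<close>, so that the optimum is at zero. All cubes then carry the
  factor \<open>1/96\<close>, and the bound \<open>1/24\<close> becomes \<open>4\<close>.

  Here the middle cells are the long ones, and in both intervals the sum of the two
  cubes increases with the deviation, so the positions of the points do not enter.\<close>

lemma cuts_outer_outer:
  assumes "u \<le> 1 / 2" "1 \<le> v"
    and le: "cut_cost 0 1 u v a b c + cut_cost (1/2) (3/2) u v a b c \<le> 1 / 24"
  shows "u = 1 / 2 \<and> v = 1"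
proof -
  define p where "p = 1 - 2 * max 0 u"
  define q where "q = 2 * min (3 / 2) v - 2"
  have clips: "clip 0 1 u = (1 - p) / 2" "clip 0 1 v = 1"
      "clip (1/2) (3/2) u = 1 / 2" "clip (1/2) (3/2) v = 1 + q / 2"
    and pq: "0 \<le> p" "p \<le> 1" "0 \<le> q" "q \<le> 1"
    using assms(1,2) by (auto simp: clip_def p_def q_def max_def min_def field_simps)
  have "(1 - p) ^ 3 / 96 \<le> cell_cost a 0 ((1 - p) / 2)"
    using cell_cost_ge_cube[of 0 "(1 - p) / 2" a] pq by (simp add: power_divide)
  moreover have "(1 + p) ^ 3 / 96 \<le> cell_cost b ((1 - p) / 2) 1"
    using cell_cost_ge_cube[of "(1 - p) / 2" 1 b] pq
    by (simp add: field_simps power3_eq_cube)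
  moreover have "(1 + q) ^ 3 / 96 \<le> cell_cost b (1 / 2) (1 + q / 2)"
    using cell_cost_ge_cube[of "1 / 2" "1 + q / 2" b] pq
    by (simp add: field_simps power3_eq_cube)
  moreover have "(1 - q) ^ 3 / 96 \<le> cell_cost c (1 + q / 2) (3 / 2)"
    using cell_cost_ge_cube[of "1 + q / 2" "3 / 2" c] pq
    by (simp add: field_simps power3_eq_cube)
  ultimately have "(1 - p) ^ 3 + (1 + p) ^ 3 + (1 + q) ^ 3 + (1 - q) ^ 3 \<le> 4"
    using le by (simp add: cut_cost_def clips) (simp add: cell_cost_def)
  then have "p\<^sup>2 + q\<^sup>2 \<le> 0"
    by (simp add: algebra_simps power2_eq_square power3_eq_cube)
  then have "p = 0" "q = 0"
    by (simp_all add: sum_power2_le_zero_iff)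
  then show ?thesis
    using assms(1,2) by (auto simp: p_def q_def max_def min_def split: if_splits)
qed

text \<open>The cubes alone would decrease by \<open>3 s\<close> to first order; the mismatch term of
  \<open>overlapping_cells_cost\<close> compensates exactly this. Of second order remains
  \<open>3 p\<^sup>2 + 3 s\<^sup>2 + 3 (p - s)\<^sup>2\<close>, which dominates the cubic remainder \<open>3 p s (p - s)\<close>, since
  \<open>p \<le> 1\<close>.\<close>

lemma cuts_outer_inner:
  assumes "u \<le> 1 / 2" "1 / 2 \<le> v" "v \<le> 1"
    and le: "cut_cost 0 1 u v a b c + cut_cost (1/2) (3/2) u v a b c \<le> 1 / 24"
  shows "u = 1 / 2 \<and> v = 1"
proof -
  define p where "p = 1 - 2 * max 0 u"
  define s where "s = 2 - 2 * v"
  have clips: "clip 0 1 u = (1 - p) / 2" "clip 0 1 v = 1 - s / 2"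
      "clip (1/2) (3/2) u = 1 / 2" "clip (1/2) (3/2) v = 1 - s / 2"
    and ps: "0 \<le> p" "p \<le> 1" "0 \<le> s" "s \<le> 1"
    using assms(1-3) by (auto simp: clip_def p_def s_def max_def min_def field_simps)
  have "(1 - p) ^ 3 / 96 \<le> cell_cost a 0 ((1 - p) / 2)"
    using cell_cost_ge_cube[of 0 "(1 - p) / 2" a] ps by (simp add: power_divide)
  moreover have "(1 + p - s) ^ 3 / 96 \<le> cell_cost b ((1 - p) / 2) (1 - s / 2)"
    using cell_cost_ge_cube[of "(1 - p) / 2" "1 - s / 2" b] ps
    by (simp add: field_simps power3_eq_cube)
  moreover have "(1 - s) ^ 3 / 96 \<le> cell_cost b (1 / 2) (1 - s / 2)"
    using cell_cost_ge_cube[of "1 / 2" "1 - s / 2" b] ps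
    by (simp add: field_simps power3_eq_cube)
  moreover note overlapping_cells_cost[OF \<open>0 \<le> s\<close>, of c]
  ultimately have "(1 - p) ^ 3 + (1 + p - s) ^ 3 + (1 - s) ^ 3
      + (s ^ 3 + (1 + s) ^ 3 + 3 * s * (1 - s)) \<le> 4"
    using le by (simp add: cut_cost_def clips) (simp add: cell_cost_def)
  then have "p\<^sup>2 + s\<^sup>2 + (p - s)\<^sup>2 \<le> p * (s * (p - s))"
    by (simp add: algebra_simps power2_eq_square power3_eq_cube)
  also have "\<dots> \<le> \<bar>s * (p - s)\<bar>"
    using ps by (metis abs_ge_self abs_ge_zero abs_mult abs_of_nonneg mult_left_le_one_le order_trans)
  also have "\<dots> \<le> (s\<^sup>2 + (p - s)\<^sup>2) / 2"
    using sum_squares_bound[of s "p - s"] sum_squares_bound[of "-s" "p - s"] by (simp add: abs_if)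
  finally have "(p\<^sup>2 + s\<^sup>2) + (p\<^sup>2 + (p - s)\<^sup>2) \<le> 0"
    by (simp add: field_simps)
  then have "p\<^sup>2 + s\<^sup>2 \<le> 0"
    by (rule order_trans[rotated]) simp
  then have "p = 0" "s = 0"
    by (simp_all add: sum_power2_le_zero_iff)
  then show ?thesis
    using assms(1,2) by (auto simp: p_def s_def max_def split: if_splits)
qed

text \<open>Both outer points have a mismatch here. The middle cell is counted twice and loses
  \<open>6 (s + t)\<close> to first order, which the two outer cells balance.\<close>

lemma cuts_inner_inner:
  assumes "1 / 2 \<le> u" "u \<le> v" "v \<le> 1"
    and le: "cut_cost 0 1 u v a b c + cut_cost (1/2) (3/2) u v a b c \<le> 1 / 24"
  shows "u = 1 / 2 \<and> v = 1"
proof -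
  define s where "s = 2 * u - 1"
  define t where "t = 2 - 2 * v"
  have clips: "clip 0 1 u = 1 / 2 + s / 2" "clip 0 1 v = 1 - t / 2"
      "clip (1/2) (3/2) u = 1 / 2 + s / 2" "clip (1/2) (3/2) v = 1 - t / 2"
    and st: "0 \<le> s" "0 \<le> t" "s + t \<le> 1"
    using assms(1-3) by (auto simp: clip_def s_def t_def max_def min_def field_simps)
  have "(1 - s - t) ^ 3 / 96 \<le> cell_cost b (1 / 2 + s / 2) (1 - t / 2)"
    using cell_cost_ge_cube[of "1 / 2 + s / 2" "1 - t / 2" b] st
    by (simp add: field_simps power3_eq_cube)
  moreover note overlapping_cells_cost[OF \<open>0 \<le> t\<close>, of c]
    overlapping_cells_cost_left[OF \<open>0 \<le> s\<close>, of a]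
  ultimately have "2 * (1 - s - t) ^ 3 + (t ^ 3 + (1 + t) ^ 3 + 3 * t * (1 - t))
      + (s ^ 3 + (1 + s) ^ 3 + 3 * s * (1 - s)) \<le> 4"
    using le by (simp add: cut_cost_def clips)
  then have "2 * (s + t)\<^sup>2 + (s ^ 3 + t ^ 3 + (s + t)\<^sup>2 * (1 - (s + t))) \<le> 0"
    by (simp add: algebra_simps power2_eq_square power3_eq_cube)
  moreover have "0 \<le> s ^ 3 + t ^ 3 + (s + t)\<^sup>2 * (1 - (s + t))"
    using st by (intro add_nonneg_nonneg mult_nonneg_nonneg) simp_all
  ultimately have "2 * (s + t)\<^sup>2 \<le> 0"
    by (meson add_increasing2 order_refl order_trans)
  then have "s = 0" "t = 0"
    using st by auto
  then show ?thesis
    by (simp add: s_def t_def)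
qed

lemma last_cell_too_long:
  assumes "u \<le> v" "v \<le> 1 / 2"
  shows "1 / 24 < cut_cost 0 1 u v a b c + cut_cost (1/2) (3/2) u v a b c"
proof -
  have "1 / 12 \<le> cell_cost c (1/2) (3/2)"
    using cell_cost_ge_cube[of "1 / 2" "3 / 2" c] by simp
  moreover have clips: "clip (1/2) (3/2) u = 1 / 2" "clip (1/2) (3/2) v = 1 / 2"
    using assms by (auto simp: clip_def)
  moreover have "0 \<le> cut_cost 0 1 u v a b c"
    unfolding cut_cost_def
    using assms by (intro add_nonneg_nonneg cell_cost_nonneg) (auto simp: clip_def)
  ultimately show ?thesis
    by (simp add: cut_cost_def[of "1/2"] clips cell_cost_def[of _ "1/2" "1/2"])
qed

text \<open>Of the six positions of the two cuts relative to \<open>1/2\<close> and \<open>1\<close>, the last two are the mirror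
  images of the second and the first.\<close>

lemma cuts_unique:
  assumes "u \<le> v"
    and le: "cut_cost 0 1 u v a b c + cut_cost (1/2) (3/2) u v a b c \<le> 1 / 24"
  shows "u = 1 / 2 \<and> v = 1"
proof -
  have refl: "cut_cost 0 1 (3/2 - v) (3/2 - u) (3/2 - c) (3/2 - b) (3/2 - a)
      + cut_cost (1/2) (3/2) (3/2 - v) (3/2 - u) (3/2 - c) (3/2 - b) (3/2 - a) \<le> 1 / 24"
    using le cut_cost_reflect[of 0 1 "3/2" v u c b a]
      cut_cost_reflect[of "1/2" "3/2" "3/2" v u c b a] by simp
  consider "v \<le> 1 / 2" | "u \<le> 1 / 2" "1 / 2 \<le> v" "v \<le> 1" | "u \<le> 1 / 2" "1 \<le> v"
    | "1 / 2 \<le> u" "v \<le> 1" | "1 / 2 \<le> u" "u \<le> 1" "1 \<le> v" | "1 \<le> u"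
    by linarith
  then show ?thesis
  proof cases
    case 1
    then show ?thesis
      using last_cell_too_long[OF assms(1), of a b c] le by simp
  next
    case 2
    then show ?thesis
      using cuts_outer_inner le by blast
  next
    case 3
    then show ?thesis
      using cuts_outer_outer le by blast
  next
    case 4
    then show ?thesis
      using cuts_inner_inner assms by blast
  next
    case 5
    then show ?thesis
      using cuts_outer_inner[OF _ _ _ refl] by simp
  next
    case 6
    then show ?thesis
      using last_cell_too_long[of "3/2 - v" "3/2 - u" "3/2 - c" "3/2 - b" "3/2 - a"] assms(1) refl
      by simp
  qed
qed

lemma cut_cost_at_half_and_one:
  "cut_cost 0 1 (1/2) 1 a b c + cut_cost (1/2) (3/2) (1/2) 1 a b c =
     1 / 24 + ((a - 1/4)\<^sup>2 + 2 * (b - 3/4)\<^sup>2 + (c - 5/4)\<^sup>2) / 2"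
  by (simp add: cut_cost_def clip_def cell_cost_def power2_eq_square power3_eq_cube field_simps)

text \<open>A smaller value would satisfy the hypothesis of \<open>cuts_unique\<close> and hence occur at the cuts
  \<open>1/2\<close> and \<open>1\<close>, where the value is at least \<open>1/24\<close>.\<close>

lemma cut_cost_minimal:
  assumes "u \<le> v"
  shows "1 / 24 \<le> cut_cost 0 1 u v a b c + cut_cost (1/2) (3/2) u v a b c"
proof (rule ccontr)
  assume lt: "\<not> ?thesis"
  then have uv: "u = 1 / 2" "v = 1"
    using cuts_unique[OF assms, of a b c] by auto
  show False
    using lt unfolding uv cut_cost_at_half_and_one by simp
qed

lemma cut_cost_minimizer:
  assumes "u \<le> v" "cut_cost 0 1 u v a b c + cut_cost (1/2) (3/2) u v a b c = 1 / 24"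
  shows "a = 1 / 4 \<and> b = 3 / 4 \<and> c = 5 / 4"
proof -
  have "u = 1 / 2" "v = 1"
    using cuts_unique[OF assms(1), of a b c] assms(2) by auto
  then have "(a - 1/4)\<^sup>2 + 2 * (b - 3/4)\<^sup>2 + (c - 5/4)\<^sup>2 = 0"
    using assms(2) by (simp only: cut_cost_at_half_and_one) simp
  moreover have "0 \<le> (a - 1/4)\<^sup>2" "0 \<le> (b - 3/4)\<^sup>2" "0 \<le> (c - 5/4)\<^sup>2"
    by simp_all
  ultimately have "(a - 1/4)\<^sup>2 = 0" "(b - 3/4)\<^sup>2 = 0" "(c - 5/4)\<^sup>2 = 0"
    by linarith+
  then show ?thesis
    by simp
qed

section \<open>The distortion of three points\<close>

lemma nn_integral_mixture:
  assumes "sets N = sets M" and f: "f \<in> borel_measurable M"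
  shows "integral\<^sup>N (mixture c M N) f =
    ennreal c * integral\<^sup>N M f + ennreal (1 - c) * integral\<^sup>N N f"
  using f
proof (induction f rule: borel_measurable_induct)
  case (cong f g)
  then show ?case
    using sets_eq_imp_space_eq[OF assms(1)] by (simp cong: nn_integral_cong_simp)
next
  case (set A)
  then show ?case
    using assms(1) by (simp add: emeasure_mixture)
next
  case (mult u d)
  then have "u \<in> borel_measurable N" "u \<in> borel_measurable (mixture c M N)"
    using assms(1) by (simp_all cong: measurable_cong_sets)
  then show ?case
    using mult by (simp add: nn_integral_cmult algebra_simps)
next
  case (add u v)
  then have "u \<in> borel_measurable N" "u \<in> borel_measurable (mixture c M N)"
    "v \<in> borel_measurable N" "v \<in> borel_measurable (mixture c M N)"
    using assms(1) by (simp_all cong: measurable_cong_sets)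
  then show ?case
    using add by (simp add: nn_integral_add algebra_simps)
next
  case (seq U)
  then have U: "U i \<in> borel_measurable N" "U i \<in> borel_measurable (mixture c M N)" for i
    using assms(1) by (simp_all cong: measurable_cong_sets)
  then have "(\<integral>\<^sup>+ x. (SUP i. U i x) \<partial>mixture c M N) =
      (SUP i. ennreal c * integral\<^sup>N M (U i) + ennreal (1 - c) * integral\<^sup>N N (U i))"
    using seq by (simp add: nn_integral_monotone_convergence_SUP)
  also have "\<dots> = (SUP i. ennreal c * integral\<^sup>N M (U i)) + (SUP i. ennreal (1 - c) * integral\<^sup>N N (U i))"
    using seq(3) by (intro ennreal_SUP_add)
      (auto simp: incseq_def le_fun_def intro!: mult_left_mono nn_integral_mono)
  also have "\<dots> = ennreal c * (\<integral>\<^sup>+ x. (SUP i. U i x) \<partial>M) +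
      ennreal (1 - c) * (\<integral>\<^sup>+ x. (SUP i. U i x) \<partial>N)"
    using seq U by (simp add: nn_integral_monotone_convergence_SUP SUP_mult_left_ennreal)
  finally show ?case
    by (simp add: image_comp)
qed

lemma nn_integral_uniform_unit_interval:
  fixes l r :: real
  assumes "r = l + 1" "m \<in> borel_measurable borel" "\<And>x. 0 \<le> m x" "(m has_integral I) {l..r}"
  shows "(\<integral>\<^sup>+ x. ennreal (m x) \<partial>uniform_measure lborel {l..r}) = ennreal I"
proof -
  have "(\<integral>\<^sup>+ x. ennreal (m x) \<partial>uniform_measure lborel {l..r}) =
      (\<integral>\<^sup>+ x. ennreal (m x) * indicator {l..r} x \<partial>lborel)"
    using assms(1,2) by (simp add: nn_integral_uniform_measure divide_ennreal_def)
  also have "\<dots> = ennreal I"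
    using assms(3,4) by (rule nn_integral_has_integral_lebesgue')
  finally show ?thesis .
qed

lemma distortion_triple:
  assumes "a \<le> b" "b \<le> c"
  shows "distortion (mixture (1/2) (uniform_measure lborel {0..1}) (uniform_measure lborel {1/2..3/2}))
      {a, b, c} =
    ennreal ((cut_cost 0 1 ((a + b) / 2) ((b + c) / 2) a b c +
      cut_cost (1/2) (3/2) ((a + b) / 2) ((b + c) / 2) a b c) / 2)"
proof -
  define m :: "real \<Rightarrow> real" where "m x = (MIN d\<in>{a, b, c}. (x - d)\<^sup>2)" for x
  define J where "J l r = cut_cost l r ((a + b) / 2) ((b + c) / 2) a b c" for l r
  have m_eq: "m x = min ((x - a)\<^sup>2) (min ((x - b)\<^sup>2) ((x - c)\<^sup>2))" for x
    by (simp add: m_def)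
  have meas: "m \<in> borel_measurable borel"
    unfolding m_eq[abs_def] by measurable
  have nonneg: "0 \<le> m x" for x
    by (simp add: m_eq)
  have int: "(m has_integral J l r) {l..r}" if "l \<le> r" for l r
    using has_integral_cut_cost[OF that assms] by (simp add: m_def[abs_def] J_def)
  have J0: "0 \<le> J l r" if "l \<le> r" for l r
    using has_integral_nonneg[OF int[OF that]] nonneg by blast
  have "distortion (mixture (1/2) (uniform_measure lborel {0..1}) (uniform_measure lborel {1/2..3/2}))
      {a, b, c} = ennreal (1/2) * ennreal (J 0 1) + ennreal (1/2) * ennreal (J (1/2) (3/2))"
    using meas unfolding distortion_def m_def[symmetric]
    by (subst nn_integral_mixture)
       (simp_all add: nn_integral_uniform_unit_interval[OF _ meas nonneg int])
  also have "\<dots> = ennreal ((J 0 1 + J (1/2) (3/2)) / 2)"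
    using J0[of 0 1] J0[of "1/2" "3/2"]
    by (simp only: add_divide_distrib flip: ennreal_mult ennreal_plus) simp
  finally show ?thesis
    by (simp add: J_def)
qed

section \<open>The optimal set of three-means\<close>

lemma sorted_triple_of_card_le_3:
  fixes \<alpha> :: "real set"
  assumes "1 \<le> card \<alpha>" "card \<alpha> \<le> 3"
  obtains a b c where "\<alpha> = {a, b, c}" "a \<le> b" "b \<le> c"
proof -
  have "card \<alpha> = 1 \<or> card \<alpha> = 2 \<or> card \<alpha> = 3"
    using assms by linarith
  then obtain x y z where xyz: "\<alpha> = {x, y, z}"
    by (metis card_1_singletonE card_2_iff card_3_iff insert_absorb2)
  have "\<exists>a b c. \<alpha> = {a, b, c} \<and> a \<le> b \<and> b \<le> c"
    unfolding xyz by (metis insert_commute linear)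
  then show ?thesis
    using that by blast
qed

theorem proposition3p3:
  fixes P\<^sub>1 P\<^sub>2 P :: "real measure"
  assumes "P\<^sub>1 = uniform_measure lborel {0..1}"
    and "P\<^sub>2 = uniform_measure lborel {1/2..3/2}"
    and "P = mixture (1/2) P\<^sub>1 P\<^sub>2"
  shows "(\<forall>\<alpha>. optimal_n_means 3 P \<alpha> \<longleftrightarrow> \<alpha> = {1/4, 3/4, 5/4}) \<and>
         quantization_error 3 P = ennreal (1/48)"
proof -
  have P: "P = mixture (1/2) (uniform_measure lborel {0..1}) (uniform_measure lborel {1/2..3/2})"
    using assms by simp
  have lower: "ennreal (1/48) \<le> distortion P \<alpha> \<and>
      (distortion P \<alpha> = ennreal (1/48) \<longrightarrow> \<alpha> = {1/4, 3/4, 5/4})"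
    if \<alpha>: "1 \<le> card \<alpha>" "card \<alpha> \<le> 3" for \<alpha>
  proof -
    obtain a b c where abc: "\<alpha> = {a, b, c}" "a \<le> b" "b \<le> c"
      using sorted_triple_of_card_le_3[OF \<alpha>] .
    define J where "J = cut_cost 0 1 ((a + b) / 2) ((b + c) / 2) a b c +
      cut_cost (1/2) (3/2) ((a + b) / 2) ((b + c) / 2) a b c"
    have D: "distortion P \<alpha> = ennreal (J / 2)"
      using distortion_triple[OF abc(2,3)] by (simp add: P abc(1) J_def)
    have ord: "(a + b) / 2 \<le> (b + c) / 2"
      using abc by simp
    have "1 / 24 \<le> J"
      unfolding J_def by (rule cut_cost_minimal[OF ord])
    moreover have "\<alpha> = {1/4, 3/4, 5/4}" if "J = 1 / 24"
      using cut_cost_minimizer[OF ord that[unfolded J_def]] abc(1) by blast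
    ultimately show ?thesis
      by (auto simp: D intro!: ennreal_leI)
  qed
  have attained: "distortion P {1/4, 3/4, 5/4} = ennreal (1/48)"
    using distortion_triple[of "1/4" "3/4" "5/4"] cut_cost_at_half_and_one[of "1/4" "3/4" "5/4"]
    by (simp add: P)
  have card: "card {1/4, 3/4, 5/4 :: real} = 3"
    by simp
  have "quantization_error 3 P = ennreal (1/48)"
    unfolding quantization_error_def
  proof (rule Inf_eqI)
    show "ennreal (1/48) \<le> d" if "d \<in> {distortion P \<alpha> |\<alpha>. 1 \<le> card \<alpha> \<and> card \<alpha> \<le> 3}" for d
      using that lower by blast
    show "y \<le> ennreal (1/48)"
      if "\<And>d. d \<in> {distortion P \<alpha> |\<alpha>. 1 \<le> card \<alpha> \<and> card \<alpha> \<le> 3} \<Longrightarrow> y \<le> d" for y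
      using that[of "distortion P {1/4, 3/4, 5/4}"] card unfolding attained[symmetric] by force
  qed
  then show ?thesis
    using lower attained card unfolding optimal_n_means_def by fastforce
qed

end
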